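(* For every integer $n \geq 2$, the monoid of pseudo braids $PM_n$ is isomorphic (as a monoid) to the singular braid monoid $SM_n$, and the group of pseudo braids $PB_n$ is isomorphic (as a group) to the singular braid group $SB_n$.
   Context: Let $n \geq 2$. The braid group $B_n$ is generated by $\sigma_1,\dots,\sigma_{n-1}$ with relations $\sigma_i\sigma_j=\sigma_j\sigma_i$ for $|i-j|\geq 2$ and $\sigma_i\sigma_{i+1}\sigma_i=\sigma_{i+1}\sigma_i\sigma_{i+1}$ for $1\le i\le n-2$. The singular braid monoid (Baez-Birman monoid) $SM_n$ is the monoid generated by $\sigma_i,\sigma_i^{-1},\tau_i$ ($i=1,\dots,n-1$) subject to: the relations of $B_n$ for the $\sigma_i^{\pm1}$ (including $\sigma_i\sigma_i^{-1}=\sigma_i^{-1}\sigma_i=1$); $\tau_i\tau_j=\tau_j\tau_i$ for $|i-j|\ge 2$; $\tau_i\sigma_j^{\pm1}=\sigma_j^{\pm1}\tau_i$ for $|i-j|\ge2$; $\tau_i\sigma_i^{\pm1}=\sigma_i^{\pm1}\tau_i$ for all $i$; $\sigma_i\sigma_{i+1}\tau_i=\tau_{i+1}\sigma_i\sigma_{i+1}$ and $\sigma_{i+1}\sigma_i\tau_{i+1}=\tau_i\sigma_{i+1}\sigma_i$ for $1\le i\le n-2$. The singular braid group $SB_n$ is the group generated by $\sigma_i,\tau_i$ ($i=1,\dots,n-1$) with the same defining relations as $SM_n$. The monoid of pseudo braids $PM_n$ is the monoid generated by $\sigma_i,\sigma_i^{-1},p_i$ ($i=1,\dots,n-1$) subject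 to: the relations of $B_n$ for the $\sigma_i^{\pm1}$ (including $\sigma_i\sigma_i^{-1}=\sigma_i^{-1}\sigma_i=1$); $p_ip_j=p_jp_i$ for $|i-j|\ge2$; $p_i\sigma_j^{\pm1}=\sigma_j^{\pm1}p_i$ for $|i-j|\ge2$; $p_i\sigma_i^{\pm1}=\sigma_i^{\pm1}p_i$ for all $i$; $\sigma_i\sigma_{i+1}p_i=p_{i+1}\sigma_i\sigma_{i+1}$ and $\sigma_{i+1}\sigma_ip_{i+1}=p_i\sigma_{i+1}\sigma_i$ for $1\le i\le n-2$. The group of pseudo braids $PB_n$ is the group generated by $\sigma_i,p_i$ ($i=1,\dots,n-1$) with the same defining relations as $PM_n$. *)

theory Defs
  imports "HOL-Algebra.Group"
begin

section \<open>Presentations by generators and relations\<close>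

inductive_set word_cong :: "'a set \<Rightarrow> ('a list \<times> 'a list) set \<Rightarrow> ('a list \<times> 'a list) set"
  for X :: "'a set" and R :: "('a list \<times> 'a list) set" where
  rel: "(u, v) \<in> R \<Longrightarrow> u \<in> lists X \<Longrightarrow> v \<in> lists X \<Longrightarrow> (u, v) \<in> word_cong X R"
| refl: "u \<in> lists X \<Longrightarrow> (u, u) \<in> word_cong X R"
| sym: "(u, v) \<in> word_cong X R \<Longrightarrow> (v, u) \<in> word_cong X R"
| trans: "(u, v) \<in> word_cong X R \<Longrightarrow> (v, w) \<in> word_cong X R \<Longrightarrow> (u, w) \<in> word_cong X R"
| mult: "(u, v) \<in> word_cong X R \<Longrightarrow> (u', v') \<in> word_cong X R \<Longrightarrow> (u @ u', v @ v') \<in> word_cong X R"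

definition presented_monoid :: "'a set \<Rightarrow> ('a list \<times> 'a list) set \<Rightarrow> 'a list set monoid" where
  "presented_monoid X R =
    \<lparr> carrier = lists X // word_cong X R,
      mult = (\<lambda>A B. \<Union>a\<in>A. \<Union>b\<in>B. word_cong X R `` {a @ b}),
      one = word_cong X R `` {[]} \<rparr>"

text \<open>In a group presentation the letter \<^term>\<open>(x, True)\<close> stands for the generator \<^term>\<open>x\<close>
  and \<^term>\<open>(x, False)\<close> for its inverse.\<close>

definition cancel_rels :: "'a set \<Rightarrow> (('a \<times> bool) list \<times> ('a \<times> bool) list) set" where
  "cancel_rels X = {([(x, b), (x, \<not> b)], []) | x b. x \<in> X}"

definition presented_group ::
    "'a set \<Rightarrow> (('a \<times> bool) list \<times> ('a \<times> bool) list) set \<Rightarrow> ('a \<times> bool) list set monoid" where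
  "presented_group X R = presented_monoid (X \<times> UNIV) (cancel_rels X \<union> R)"

lemma word_cong_lists:
  "(u, v) \<in> word_cong X R \<Longrightarrow> u \<in> lists X \<and> v \<in> lists X"
  by (induction rule: word_cong.induct) auto

lemma equiv_word_cong: "equiv (lists X) (word_cong X R)"
proof (rule equivI)
  show "word_cong X R \<subseteq> lists X \<times> lists X"
    by (auto simp del: in_lists_conv_set dest: word_cong_lists)
  show "refl_on (lists X) (word_cong X R)"
    by (auto intro!: refl_onI word_cong.refl)
  show "Relation.sym (word_cong X R)"
    by (auto intro!: symI word_cong.sym)
  show "Relation.trans (word_cong X R)"
    by (auto intro!: transI intro: word_cong.trans)
qed

lemma presented_monoid_mult_class:
  assumes "u \<in> lists X" "v \<in> lists X"
  shows "word_cong X R `` {u} \<otimes>\<^bsub>presented_monoid X R\<^esub> word_cong X R `` {v} = word_cong X R `` {u @ v}"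
proof -
  have "congruent2 (word_cong X R) (word_cong X R) (\<lambda>a b. word_cong X R `` {a @ b})"
    by (rule congruent2I')
      (use equiv_class_eq[OF equiv_word_cong] word_cong.mult in \<open>blast\<close>)
  from UN_equiv_class2[OF equiv_word_cong equiv_word_cong this assms]
  show ?thesis
    by (simp add: presented_monoid_def)
qed

lemma presented_monoid_carrierE:
  assumes "A \<in> carrier (presented_monoid X R)"
  obtains u where "u \<in> lists X" "A = word_cong X R `` {u}"
  using assms unfolding presented_monoid_def by (auto simp del: in_lists_conv_set elim!: quotientE)

lemma presented_monoid_class_carrier:
  "u \<in> lists X \<Longrightarrow> word_cong X R `` {u} \<in> carrier (presented_monoid X R)"
  by (simp add: presented_monoid_def quotientI)

lemma presented_monoid_one: "\<one>\<^bsub>presented_monoid X R\<^esub> = word_cong X R `` {[]}"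
  by (simp add: presented_monoid_def)

lemma monoid_presented_monoid: "monoid (presented_monoid X R)"
proof (rule monoidI)
  fix A B C
  assume "A \<in> carrier (presented_monoid X R)" "B \<in> carrier (presented_monoid X R)"
  then show "A \<otimes>\<^bsub>presented_monoid X R\<^esub> B \<in> carrier (presented_monoid X R)"
    by (elim presented_monoid_carrierE)
      (simp add: presented_monoid_mult_class presented_monoid_class_carrier del: in_lists_conv_set)
next
  fix A B C
  assume "A \<in> carrier (presented_monoid X R)" "B \<in> carrier (presented_monoid X R)"
    "C \<in> carrier (presented_monoid X R)"
  then show "A \<otimes>\<^bsub>presented_monoid X R\<^esub> B \<otimes>\<^bsub>presented_monoid X R\<^esub> C =
      A \<otimes>\<^bsub>presented_monoid X R\<^esub> (B \<otimes>\<^bsub>presented_monoid X R\<^esub> C)"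
    by (elim presented_monoid_carrierE)
      (simp add: presented_monoid_mult_class del: in_lists_conv_set)
next
  show "\<one>\<^bsub>presented_monoid X R\<^esub> \<in> carrier (presented_monoid X R)"
    by (simp add: presented_monoid_one presented_monoid_class_carrier)
next
  fix A assume "A \<in> carrier (presented_monoid X R)"
  then show "\<one>\<^bsub>presented_monoid X R\<^esub> \<otimes>\<^bsub>presented_monoid X R\<^esub> A = A"
    by (elim presented_monoid_carrierE)
      (simp add: presented_monoid_one presented_monoid_mult_class del: in_lists_conv_set)
next
  fix A assume "A \<in> carrier (presented_monoid X R)"
  then show "A \<otimes>\<^bsub>presented_monoid X R\<^esub> \<one>\<^bsub>presented_monoid X R\<^esub> = A"
    by (elim presented_monoid_carrierE)
      (simp add: presented_monoid_one presented_monoid_mult_class del: in_lists_conv_set)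
qed

lemma presented_group_left_inverse:
  assumes "u \<in> lists (X \<times> UNIV)"
  shows "\<exists>v\<in>lists (X \<times> UNIV). (v @ u, []) \<in> word_cong (X \<times> UNIV) (cancel_rels X \<union> R)"
  using assms
proof (induction u)
  case Nil
  show ?case
    by (intro bexI[of _ "[]"]) (auto intro: word_cong.refl)
next
  case (Cons a u)
  let ?C = "word_cong (X \<times> UNIV) (cancel_rels X \<union> R)"
  obtain x b where a: "a = (x, b)" "x \<in> X" using Cons by auto
  from Cons obtain v where v: "v \<in> lists (X \<times> UNIV)" "(v @ u, []) \<in> ?C" by auto
  have u: "u \<in> lists (X \<times> UNIV)" using Cons by auto
  have "([(x, \<not> b), (x, \<not> \<not> b)], []) \<in> cancel_rels X"
    unfolding cancel_rels_def using a(2) by blast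
  then have "([(x, \<not> b), (x, b)], []) \<in> ?C"
    using a by (intro word_cong.rel) auto
  from word_cong.mult[OF word_cong.mult[OF word_cong.refl[OF v(1)] this] word_cong.refl[OF u]]
  have "((v @ [(x, \<not> b)]) @ a # u, v @ u) \<in> ?C"
    using a by simp
  with v(2) have "((v @ [(x, \<not> b)]) @ a # u, []) \<in> ?C"
    by (blast intro: word_cong.trans)
  moreover have "v @ [(x, \<not> b)] \<in> lists (X \<times> UNIV)" using v(1) a by auto
  ultimately show ?case by blast
qed

lemma group_presented_group: "group (presented_group X R)"
proof -
  let ?G = "presented_monoid (X \<times> UNIV) (cancel_rels X \<union> R)"
  interpret monoid ?G by (rule monoid_presented_monoid)
  have "group ?G"
  proof (rule groupI)
    fix A assume "A \<in> carrier ?G"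
    then obtain u where u: "u \<in> lists (X \<times> UNIV)"
      "A = word_cong (X \<times> UNIV) (cancel_rels X \<union> R) `` {u}"
      by (rule presented_monoid_carrierE)
    obtain v where v: "v \<in> lists (X \<times> UNIV)"
      "(v @ u, []) \<in> word_cong (X \<times> UNIV) (cancel_rels X \<union> R)"
      using presented_group_left_inverse[OF u(1)] by blast
    have "word_cong (X \<times> UNIV) (cancel_rels X \<union> R) `` {v} \<otimes>\<^bsub>?G\<^esub> A = \<one>\<^bsub>?G\<^esub>"
      unfolding u(2) presented_monoid_mult_class[OF v(1) u(1)] presented_monoid_one
      by (rule equiv_class_eq[OF equiv_word_cong v(2)])
    then show "\<exists>B\<in>carrier ?G. B \<otimes>\<^bsub>?G\<^esub> A = \<one>\<^bsub>?G\<^esub>"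
      using presented_monoid_class_carrier[OF v(1)] by blast
  qed (auto simp: m_assoc)
  then show ?thesis by (simp add: presented_group_def)
qed

section \<open>The braid relations\<close>

text \<open>Here \<^term>\<open>s i\<close> and \<^term>\<open>s' i\<close> are the letters for \<open>\<sigma>\<^sub>i\<close> and its inverse.\<close>

definition braid_rels :: "nat \<Rightarrow> (nat \<Rightarrow> 'a) \<Rightarrow> (nat \<Rightarrow> 'a) \<Rightarrow> ('a list \<times> 'a list) set" where
  "braid_rels n s s' =
     {([s i, s' i], []) | i. i \<in> {1..n-1}}
   \<union> {([s' i, s i], []) | i. i \<in> {1..n-1}}
   \<union> {([s i, s j], [s j, s i]) | i j. i \<in> {1..n-1} \<and> j \<in> {1..n-1} \<and> \<bar>int i - int j\<bar> \<ge> 2}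
   \<union> {([s i, s (i+1), s i], [s (i+1), s i, s (i+1)]) | i. i \<in> {1..n-2}}"

section \<open>Singular braids\<close>

datatype sing_letter = Sig nat | SigInv nat | Tau nat

datatype sing_gen = SigGen nat | TauGen nat

definition sing_rels :: "nat \<Rightarrow> (sing_letter list \<times> sing_letter list) set" where
  "sing_rels n = braid_rels n Sig SigInv
   \<union> {([Tau i, Tau j], [Tau j, Tau i]) | i j.
        i \<in> {1..n-1} \<and> j \<in> {1..n-1} \<and> \<bar>int i - int j\<bar> \<ge> 2}
   \<union> {([Tau i, Sig j], [Sig j, Tau i]) | i j.
        i \<in> {1..n-1} \<and> j \<in> {1..n-1} \<and> \<bar>int i - int j\<bar> \<ge> 2}
   \<union> {([Tau i, SigInv j], [SigInv j, Tau i]) | i j.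
        i \<in> {1..n-1} \<and> j \<in> {1..n-1} \<and> \<bar>int i - int j\<bar> \<ge> 2}
   \<union> {([Tau i, Sig i], [Sig i, Tau i]) | i. i \<in> {1..n-1}}
   \<union> {([Tau i, SigInv i], [SigInv i, Tau i]) | i. i \<in> {1..n-1}}
   \<union> {([Sig i, Sig (i+1), Tau i], [Tau (i+1), Sig i, Sig (i+1)]) | i. i \<in> {1..n-2}}
   \<union> {([Sig (i+1), Sig i, Tau (i+1)], [Tau i, Sig (i+1), Sig i]) | i. i \<in> {1..n-2}}"

definition singular_braid_monoid :: "nat \<Rightarrow> sing_letter list set monoid" where
  "singular_braid_monoid n =
     presented_monoid (Sig ` {1..n-1} \<union> SigInv ` {1..n-1} \<union> Tau ` {1..n-1}) (sing_rels n)"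

fun sing_signed :: "sing_letter \<Rightarrow> sing_gen \<times> bool" where
  "sing_signed (Sig i) = (SigGen i, True)"
| "sing_signed (SigInv i) = (SigGen i, False)"
| "sing_signed (Tau i) = (TauGen i, True)"

definition singular_braid_group :: "nat \<Rightarrow> (sing_gen \<times> bool) list set monoid" where
  "singular_braid_group n =
     presented_group (SigGen ` {1..n-1} \<union> TauGen ` {1..n-1})
       {(map sing_signed u, map sing_signed v) | u v. (u, v) \<in> sing_rels n}"

section \<open>Pseudo braids\<close>

datatype pseudo_letter = PSig nat | PSigInv nat | Pre nat

datatype pseudo_gen = PSigGen nat | PreGen nat

text \<open>\<^term>\<open>Pre i\<close> and \<^term>\<open>PreGen i\<close> stand for the pre-crossing \<open>p\<^sub>i\<close>.\<close>

definition pseudo_rels :: "nat \<Rightarrow> (pseudo_letter list \<times> pseudo_letter list) set" where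
  "pseudo_rels n = braid_rels n PSig PSigInv
   \<union> {([Pre i, Pre j], [Pre j, Pre i]) | i j.
        i \<in> {1..n-1} \<and> j \<in> {1..n-1} \<and> \<bar>int i - int j\<bar> \<ge> 2}
   \<union> {([Pre i, PSig j], [PSig j, Pre i]) | i j.
        i \<in> {1..n-1} \<and> j \<in> {1..n-1} \<and> \<bar>int i - int j\<bar> \<ge> 2}
   \<union> {([Pre i, PSigInv j], [PSigInv j, Pre i]) | i j.
        i \<in> {1..n-1} \<and> j \<in> {1..n-1} \<and> \<bar>int i - int j\<bar> \<ge> 2}
   \<union> {([Pre i, PSig i], [PSig i, Pre i]) | i. i \<in> {1..n-1}}
   \<union> {([Pre i, PSigInv i], [PSigInv i, Pre i]) | i. i \<in> {1..n-1}}
   \<union> {([PSig i, PSig (i+1), Pre i], [Pre (i+1), PSig i, PSig (i+1)]) | i. i \<in> {1..n-2}}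
   \<union> {([PSig (i+1), PSig i, Pre (i+1)], [Pre i, PSig (i+1), PSig i]) | i. i \<in> {1..n-2}}"

definition pseudo_braid_monoid :: "nat \<Rightarrow> pseudo_letter list set monoid" where
  "pseudo_braid_monoid n =
     presented_monoid (PSig ` {1..n-1} \<union> PSigInv ` {1..n-1} \<union> Pre ` {1..n-1}) (pseudo_rels n)"

fun pseudo_signed :: "pseudo_letter \<Rightarrow> pseudo_gen \<times> bool" where
  "pseudo_signed (PSig i) = (PSigGen i, True)"
| "pseudo_signed (PSigInv i) = (PSigGen i, False)"
| "pseudo_signed (Pre i) = (PreGen i, True)"

definition pseudo_braid_group :: "nat \<Rightarrow> (pseudo_gen \<times> bool) list set monoid" where
  "pseudo_braid_group n =
     presented_group (PSigGen ` {1..n-1} \<union> PreGen ` {1..n-1})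
       {(map pseudo_signed u, map pseudo_signed v) | u v. (u, v) \<in> pseudo_rels n}"

end

theory Submission
  imports Defs
begin

text \<open>Replacing \<open>p\<^sub>i\<close> by \<open>\<tau>\<^sub>i\<close> is a bijection between the generators which carries the
  defining relations of the pseudo braids exactly onto those of the singular braids, and such a
  renaming of letters induces an isomorphism of the presented monoids. A group presentation is the
  special case of a monoid presentation on signed letters.\<close>

abbreviation map_rels :: "('a \<Rightarrow> 'b) \<Rightarrow> ('a list \<times> 'a list) set \<Rightarrow> ('b list \<times> 'b list) set" where
  "map_rels f \<equiv> image (map_prod (map f) (map f))"

text \<open>The defining relations are families indexed by one or two integers. These equations push
  a renaming inside each family.\<close>

lemma map_rels_Collect:
  "map_rels f {(u i, v i) | i. P i} = {(map f (u i), map f (v i)) | i. P i}"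
  "map_rels f {(u' i j, v' i j) | i j. Q i j} = {(map f (u' i j), map f (v' i j)) | i j. Q i j}"
  unfolding image_def map_prod_def by auto

text \<open>Each step of a derivation is renamed to a step of the same kind. The map
  \<open>f\<close> is arbitrary because \<open>inv_into UNIV f\<close>, which need not be injective,
  is also used in its place.\<close>

lemma word_cong_map:
  assumes "(u, v) \<in> word_cong X R"
  shows "(map f u, map f v) \<in> word_cong (f ` X) (map_rels f R)"
  using assms
proof induction
  case (rel u v)
  then show ?case by (intro word_cong.rel) force+
next
  case (refl u)
  then show ?case by (intro word_cong.refl) auto
next
  case (sym u v)
  then show ?case by (blast intro: word_cong.sym)
next
  case (trans u v w)
  then show ?case by (blast intro: word_cong.trans)
next
  case (mult u v u' v')
  then show ?case by (simp add: word_cong.mult)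
qed

lemma word_cong_map_iff:
  assumes "inj f"
  shows "(map f u, map f v) \<in> word_cong (f ` X) (map_rels f R) \<longleftrightarrow> (u, v) \<in> word_cong X R"
proof
  assume "(map f u, map f v) \<in> word_cong (f ` X) (map_rels f R)"
  \<comment> \<open>The left inverse of \<open>f\<close> undoes the renaming in the words, in the
    alphabet and in the relations alike.\<close>
  from word_cong_map[OF this, of "inv_into UNIV f"] show "(u, v) \<in> word_cong X R"
    using assms by (simp add: image_comp map_prod_compose[symmetric] prod.map_id0)
qed (rule word_cong_map)

lemma word_cong_class_map:
  assumes "inj f"
  shows "word_cong (f ` X) (map_rels f R) `` {map f u} = map f ` (word_cong X R `` {u})"
proof (rule Set.set_eqI)
  fix w
  have "w \<in> range (map f)" if "(map f u, w) \<in> word_cong (f ` X) (map_rels f R)"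
    using word_cong_lists[OF that] by (auto simp: lists_image simp del: in_lists_conv_set)
  then show "w \<in> word_cong (f ` X) (map_rels f R) `` {map f u} \<longleftrightarrow>
      w \<in> map f ` (word_cong X R `` {u})"
    using word_cong_map_iff[OF assms] by fastforce
qed

lemma presented_monoid_rename_iso:
  assumes "inj f"
  shows "image (map f) \<in> iso (presented_monoid X R) (presented_monoid (f ` X) (map_rels f R))"
    (is "_ \<in> iso ?M ?N")
proof (rule isoI)
  note cls = word_cong_class_map[OF assms, symmetric]
  have map_lists: "map f u \<in> lists (f ` X)" if "u \<in> lists X" for u
    using that by auto
  show "image (map f) \<in> hom ?M ?N"
  proof (rule homI)
    fix A assume "A \<in> carrier ?M"
    then show "map f ` A \<in> carrier ?N"
      by (metis presented_monoid_carrierE cls map_lists presented_monoid_class_carrier)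
  next
    fix A B assume "A \<in> carrier ?M" "B \<in> carrier ?M"
    then show "map f ` (A \<otimes>\<^bsub>?M\<^esub> B) = map f ` A \<otimes>\<^bsub>?N\<^esub> map f ` B"
      by (elim presented_monoid_carrierE)
        (simp add: presented_monoid_mult_class cls map_lists del: in_lists_conv_set)
  qed
  show "bij_betw (image (map f)) (carrier ?M) (carrier ?N)"
  proof (rule bij_betw_imageI)
    show "inj_on (image (map f)) (carrier ?M)"
      \<comment> \<open>An injective map has an injective direct image on arbitrary sets of words,
        in particular on classes.\<close>
      using assms by (auto intro!: inj_onI simp: inj_image_eq_iff)
    have "A \<in> image (map f) ` carrier ?M" if "A \<in> carrier ?N" for A
    proof -
      from that obtain u where "u \<in> lists X" "A = word_cong (f ` X) (map_rels f R) `` {map f u}"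
        by (elim presented_monoid_carrierE) (auto simp: lists_image simp del: in_lists_conv_set)
      then show ?thesis
        by (simp add: word_cong_class_map[OF assms] presented_monoid_class_carrier
            del: in_lists_conv_set)
    qed
    moreover have "map f ` A \<in> carrier ?N" if "A \<in> carrier ?M" for A
      using \<open>image (map f) \<in> hom ?M ?N\<close> that by (rule hom_in_carrier)
    ultimately show "image (image (map f)) (carrier ?M) = carrier ?N"
      by blast
  qed
qed

text \<open>Membership in \<open>iso\<close> speaks only of products and bijectivity, so the unit is
  treated apart: it is the class of the empty word, which \<open>map f\<close> fixes.\<close>

lemma presented_monoid_rename_one:
  assumes "inj f"
  shows "map f ` \<one>\<^bsub>presented_monoid X R\<^esub> = \<one>\<^bsub>presented_monoid (f ` X) (map_rels f R)\<^esub>"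
  using word_cong_class_map[OF assms, of X R "[]"] by (simp add: presented_monoid_one)

lemma cancel_rels_rename: "cancel_rels (g ` X) = map_rels (map_prod g id) (cancel_rels X)"
  unfolding cancel_rels_def map_rels_Collect by auto

text \<open>The map \<open>map_prod g id\<close> renames generators and keeps signs, so it carries
  cancellation relations to cancellation relations, and the monoid case applies.\<close>

lemma presented_group_rename_iso:
  assumes "inj g"
  shows "presented_group X R \<cong> presented_group (g ` X) (map_rels (map_prod g id) R)"
proof -
  have "inj (map_prod g (id :: bool \<Rightarrow> bool))"
    using assms by (simp add: prod.inj_map)
  moreover have "g ` X \<times> UNIV = map_prod g id ` (X \<times> (UNIV :: bool set))"
    by (simp add: map_prod_surj_on)
  ultimately show ?thesis
    unfolding presented_group_def is_iso_def
    using presented_monoid_rename_iso[of "map_prod g id" "X \<times> UNIV" "cancel_rels X \<union> R"]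
    by (auto simp: cancel_rels_rename image_Un)
qed

fun sing_of_pseudo :: "pseudo_letter \<Rightarrow> sing_letter" where
  "sing_of_pseudo (PSig i) = Sig i"
| "sing_of_pseudo (PSigInv i) = SigInv i"
| "sing_of_pseudo (Pre i) = Tau i"

fun sing_gen_of_pseudo :: "pseudo_gen \<Rightarrow> sing_gen" where
  "sing_gen_of_pseudo (PSigGen i) = SigGen i"
| "sing_gen_of_pseudo (PreGen i) = TauGen i"

lemma inj_sing_of_pseudo: "inj sing_of_pseudo"
proof (rule injI)
  fix x y assume "sing_of_pseudo x = sing_of_pseudo y"
  then show "x = y" by (cases x; cases y) auto
qed

lemma inj_sing_gen_of_pseudo: "inj sing_gen_of_pseudo"
proof (rule injI)
  fix x y assume "sing_gen_of_pseudo x = sing_gen_of_pseudo y"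
  then show "x = y" by (cases x; cases y) auto
qed

text \<open>This commuting square carries the comparison of relations from monoid letters to signed
  generators.\<close>

lemma sing_signed_sing_of_pseudo:
  "sing_signed (sing_of_pseudo x) = map_prod sing_gen_of_pseudo id (pseudo_signed x)"
  by (cases x) auto

text \<open>Both unions list their families in the same order, so after renaming they agree family
  by family.\<close>

lemma sing_rels_eq_map_rels: "sing_rels n = map_rels sing_of_pseudo (pseudo_rels n)"
  unfolding sing_rels_def pseudo_rels_def braid_rels_def image_Un map_rels_Collect by simp

lemma signed_sing_rels_eq_map_rels:
  "{(map sing_signed u, map sing_signed v) | u v. (u, v) \<in> sing_rels n} =
   map_rels (map_prod sing_gen_of_pseudo id)
     {(map pseudo_signed u, map pseudo_signed v) | u v. (u, v) \<in> pseudo_rels n}"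
proof -
  have signed: "map sing_signed (map sing_of_pseudo u) =
      map (map_prod sing_gen_of_pseudo id) (map pseudo_signed u)" for u
    by (simp add: sing_signed_sing_of_pseudo)
  show ?thesis
    unfolding sing_rels_eq_map_rels map_rels_Collect signed[symmetric] by force
qed

theorem proposition2p3:
  fixes n :: nat
  assumes "n \<ge> 2"
  shows "(\<exists>h \<in> iso (pseudo_braid_monoid n) (singular_braid_monoid n).
            h \<one>\<^bsub>pseudo_braid_monoid n\<^esub> = \<one>\<^bsub>singular_braid_monoid n\<^esub>)
       \<and> pseudo_braid_group n \<cong> singular_braid_group n"
proof
  let ?X = "PSig ` {1..n-1} \<union> PSigInv ` {1..n-1} \<union> Pre ` {1..n-1}"
  have "sing_of_pseudo ` ?X = Sig ` {1..n-1} \<union> SigInv ` {1..n-1} \<union> Tau ` {1..n-1}"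
    by (simp add: image_Un image_image)
  then have "singular_braid_monoid n =
      presented_monoid (sing_of_pseudo ` ?X) (map_rels sing_of_pseudo (pseudo_rels n))"
    by (simp only: singular_braid_monoid_def sing_rels_eq_map_rels)
  \<comment> \<open>The witness is \<open>image (map sing_of_pseudo)\<close>.\<close>
  then show "\<exists>h \<in> iso (pseudo_braid_monoid n) (singular_braid_monoid n).
      h \<one>\<^bsub>pseudo_braid_monoid n\<^esub> = \<one>\<^bsub>singular_braid_monoid n\<^esub>"
    unfolding pseudo_braid_monoid_def
    using presented_monoid_rename_iso[OF inj_sing_of_pseudo]
      presented_monoid_rename_one[OF inj_sing_of_pseudo] by metis
next
  let ?Y = "PSigGen ` {1..n-1} \<union> PreGen ` {1..n-1}"
  have "sing_gen_of_pseudo ` ?Y = SigGen ` {1..n-1} \<union> TauGen ` {1..n-1}"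
    by (simp add: image_Un image_image)
  from presented_group_rename_iso[OF inj_sing_gen_of_pseudo, of ?Y, unfolded this]
  show "pseudo_braid_group n \<cong> singular_braid_group n"
    unfolding pseudo_braid_group_def singular_braid_group_def signed_sing_rels_eq_map_rels .
qed

end
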